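(* Let $n \ge 3$. Any deterministic algorithm that, for every undirected graph on vertex set $[n]$ with non-negative real edge weights, outputs exactly the max cut value $\max_{S \subseteq [n]} F(S)$ using cut queries must make at least $\binom{n}{2}$ queries when $n$ is odd, and at least $\binom{n-1}{2}$ queries when $n$ is even. In particular, the deterministic query complexity of exactly computing the max cut value of a weighted undirected graph is $\Omega(n^2)$.
   Context: Cut query model: an undirected graph $G$ on vertex set $[n]$ has non-negative edge weights $w_{i,j}$, and its cut function is $F(S) = \sum_{i \in S, j \notin S} w_{i,j}$ for $S \subseteq [n]$. An algorithm has no access to $G$ except through queries: it submits a set $S \subseteq [n]$ and receives $F(S)$; queries may be adaptive, computation is unlimited, and the query complexity is the number of queries. *)

theory Defs
  imports Complex_Main "HOL-Library.Landau_Symbols"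
begin

text \<open>A graph on the vertex set \<open>{1..n}\<close> is given by its weight matrix; weight \<open>0\<close> means that
  there is no edge. Entries of the matrix outside \<open>{1..n}\<close> are never used.\<close>

definition weighted_graphs :: "nat \<Rightarrow> (nat \<Rightarrow> nat \<Rightarrow> real) set" where
  "weighted_graphs n =
    {w. \<forall>i\<in>{1..n}. \<forall>j\<in>{1..n}. w i j \<ge> 0 \<and> w i j = w j i \<and> w i i = 0}"

definition cut_value :: "nat \<Rightarrow> (nat \<Rightarrow> nat \<Rightarrow> real) \<Rightarrow> nat set \<Rightarrow> real" where
  "cut_value n w S = (\<Sum>i\<in>S. \<Sum>j\<in>{1..n} - S. w i j)"

definition max_cut :: "nat \<Rightarrow> (nat \<Rightarrow> nat \<Rightarrow> real) \<Rightarrow> real" where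
  "max_cut n w = Max (cut_value n w ` Pow {1..n})"

text \<open>A deterministic adaptive algorithm is a decision tree with one branch per possible answer,
  so computation between queries is unrestricted. Every branch of the tree is finite, but the tree
  may have unbounded depth. Finiteness of branches loses no generality: if an algorithm never stops
  along some infinite branch, that branch involves only finitely many distinct sets, so either
  some finite part of it is already inconsistent with every graph and it can be cut off there, or
  it is followed on an actual graph, on which the algorithm then has no output.\<close>

datatype cut_algorithm =
    Output real
  | Query "nat set" "real \<Rightarrow> cut_algorithm"

text \<open>The second argument below is the oracle that answers the queries.\<close>

primrec result :: "cut_algorithm \<Rightarrow> (nat set \<Rightarrow> real) \<Rightarrow> real" where
  "result (Output v) F = v"
| "result (Query S next) F = result (next (F S)) F"

primrec queries :: "cut_algorithm \<Rightarrow> (nat set \<Rightarrow> real) \<Rightarrow> nat set list" where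
  "queries (Output v) F = []"
| "queries (Query S next) F = S # queries (next (F S)) F"

definition num_queries :: "cut_algorithm \<Rightarrow> (nat set \<Rightarrow> real) \<Rightarrow> nat" where
  "num_queries A F = length (queries A F)"

definition computes_max_cut :: "nat \<Rightarrow> cut_algorithm \<Rightarrow> bool" where
  "computes_max_cut n A \<longleftrightarrow>
    (\<forall>w\<in>weighted_graphs n.
       (\<forall>S\<in>set (queries A (cut_value n w)). S \<subseteq> {1..n}) \<and>
       result A (cut_value n w) = max_cut n w)"

definition max_cut_query_complexity :: "nat \<Rightarrow> nat" where
  "max_cut_query_complexity n =
    (LEAST q. \<exists>A. computes_max_cut n A \<and>
       (\<forall>w\<in>weighted_graphs n. num_queries A (cut_value n w) \<le> q))"

text \<open>The \<open>LEAST\<close> above is attained: one can simply query every subset.\<close>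

primrec query_all :: "nat set list \<Rightarrow> real list \<Rightarrow> cut_algorithm" where
  "query_all [] rs = Output (Max (set rs))"
| "query_all (S # Ss) rs = Query S (\<lambda>r. query_all Ss (r # rs))"

lemma queries_query_all: "queries (query_all Ss rs) F = Ss"
  by (induction Ss arbitrary: rs) auto

lemma result_query_all: "result (query_all Ss rs) F = Max (F ` set Ss \<union> set rs)"
  by (induction Ss arbitrary: rs) auto

lemma max_cut_query_complexity_attained:
  "\<exists>A. computes_max_cut n A \<and>
     (\<forall>w\<in>weighted_graphs n. num_queries A (cut_value n w) \<le> max_cut_query_complexity n)"
proof -
  obtain Ss where Ss: "set Ss = Pow {1..n}"
    using finite_list[of "Pow {1..n}"] by auto
  have "computes_max_cut n (query_all Ss [])"
    using Ss by (auto simp: computes_max_cut_def queries_query_all result_query_all max_cut_def)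
  moreover have "num_queries (query_all Ss []) F \<le> length Ss" for F
    by (simp add: num_queries_def queries_query_all)
  ultimately have "\<exists>A. computes_max_cut n A \<and>
      (\<forall>w\<in>weighted_graphs n. num_queries A (cut_value n w) \<le> length Ss)"
    by blast
  then show ?thesis
    unfolding max_cut_query_complexity_def by (rule LeastI)
qed

end

theory Submission
  imports Defs
begin

text \<open>Run the algorithm on the complete graph on \<open>m = 2 * k + 1\<close> of the \<open>n\<close> vertices,
  where \<open>m\<close> is \<open>n\<close> or \<open>n - 1\<close> according to parity. If it makes
  fewer than \<open>m choose 2\<close> queries, some nonzero perturbation \<open>z\<close> of the weights of this graph is
  invisible to all queries. If \<open>z\<close> changed the value of any cut with \<open>k\<close> or \<open>k + 1\<close> vertices on
  one side, all of which are maximum cuts, then a small multiple of \<open>z\<close> or \<open>- z\<close> would increase the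
  maximum without changing the answers. So \<open>z\<close> vanishes on all these balanced cuts.
  Comparing the cuts \<open>S\<close> and \<open>insert v S\<close> with \<open>card S = k\<close> shows that \<open>v\<close> sends half of its degree
  into every such \<open>S\<close>; exchanging one element of \<open>S\<close> shows that \<open>z\<close> is constant, hence zero.\<close>

section \<open>Underdetermined homogeneous linear systems\<close>

text \<open>Gaussian elimination: each step removes one equation and at most one unknown, so an
  unknown remains when the equations run out.\<close>

lemma homogeneous_system_nontrivial_solution:
  fixes as :: "('a \<Rightarrow> real) list"
  assumes "finite P" "length as < card P"
  shows "\<exists>x. (\<exists>p\<in>P. x p \<noteq> 0) \<and> (\<forall>a\<in>set as. (\<Sum>p\<in>P. a p * x p) = 0)"
  using assms
proof (induction "length as" arbitrary: as P)
  case 0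
  then have "P \<noteq> {}" by auto
  with 0 show ?case by (intro exI[of _ "\<lambda>_. 1"]) auto
next
  case (Suc l)
  then obtain a bs where as: "as = a # bs" and l: "l = length bs"
    by (cases as) auto
  show ?case
  proof (cases "\<exists>p\<in>P. a p \<noteq> 0")
    case False
    moreover have "\<exists>x. (\<exists>p\<in>P. x p \<noteq> 0) \<and> (\<forall>b\<in>set bs. (\<Sum>p\<in>P. b p * x p) = 0)"
      using Suc.prems as by (intro Suc.hyps(1)[OF l]) auto
    ultimately show ?thesis by (auto simp: as)
  next
    case True
    then obtain p where p: "p \<in> P" "a p \<noteq> 0" by blast
    \<comment> \<open>Solving the equation \<open>a\<close> for the unknown \<open>p\<close> and
      substituting into the others gives the system \<open>cs\<close> on
      \<open>P - {p}\<close>.\<close>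
    define cs where "cs = map (\<lambda>b q. b q - b p * a q / a p) bs"
    have "\<exists>x. (\<exists>q\<in>P - {p}. x q \<noteq> 0) \<and> (\<forall>c\<in>set cs. (\<Sum>q\<in>P - {p}. c q * x q) = 0)"
      using Suc.prems as l p by (intro Suc.hyps(1)) (auto simp: cs_def)
    then obtain x q where q: "q \<in> P - {p}" "x q \<noteq> 0"
      and x: "\<And>c. c \<in> set cs \<Longrightarrow> (\<Sum>q\<in>P - {p}. c q * x q) = 0" by blast
    define s where "s = (\<Sum>q\<in>P - {p}. a q * x q)"
    \<comment> \<open>The value at \<open>p\<close> is forced by the eliminated equation
      \<open>a\<close>.\<close>
    define y where "y = x(p := - s / a p)"
    have split: "(\<Sum>q\<in>P. b q * y q) = (\<Sum>q\<in>P - {p}. b q * x q) - b p * s / a p" for b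
      using p Suc.prems(1) by (subst sum.remove[of _ p]) (auto simp: y_def)
    have "(\<Sum>q\<in>P. b q * y q) = 0" if "b \<in> set bs" for b
    proof -
      have "0 = (\<Sum>q\<in>P - {p}. (b q - b p * a q / a p) * x q)"
        using that by (intro x[symmetric]) (auto simp: cs_def)
      also have "\<dots> = (\<Sum>q\<in>P - {p}. b q * x q) - b p * s / a p"
        by (simp add: s_def left_diff_distrib sum_subtractf sum_distrib_left sum_divide_distrib mult.assoc)
      finally show ?thesis by (simp add: split)
    qed
    moreover have "(\<Sum>q\<in>P. a q * y q) = 0"
      using p by (simp add: split s_def)
    moreover have "y q \<noteq> 0" using q by (auto simp: y_def)
    ultimately show ?thesis using q by (auto simp: as intro!: exI[of _ y])
  qed
qed

section \<open>Weights that vanish on all balanced cuts\<close>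

lemma balanced_cuts_determine_weights:
  fixes z :: "'a \<Rightarrow> 'a \<Rightarrow> real"
  assumes V: "finite V" "card V = 2 * k + 1" "k \<ge> 1"
    and sym: "\<And>i j. z i j = z j i"
    and cut: "\<And>S. S \<subseteq> V \<Longrightarrow> card S = k \<or> card S = k + 1 \<Longrightarrow> (\<Sum>i\<in>S. \<Sum>j\<in>V - S. z i j) = 0"
    and ij: "i \<in> V" "j \<in> V" "i \<noteq> j"
  shows "z i j = 0"
proof -
  have half: "2 * (\<Sum>i\<in>S. z v i) = (\<Sum>i\<in>V - {v}. z v i)"
    if S: "S \<subseteq> V - {v}" "card S = k" and v: "v \<in> V" for S v
  proof -
    let ?R = "V - insert v S"
    have fin: "finite S" using S V finite_subset by blast
    have VS: "V - S = insert v ?R" using S v by auto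
    \<comment> \<open>The cuts at \<open>S\<close> and \<open>insert v S\<close> share the edges
      between \<open>S\<close> and \<open>?R\<close>. Their difference therefore equates the weight
      from \<open>v\<close> into \<open>S\<close> with that from \<open>v\<close> into
      \<open>?R\<close>.\<close>
    have "(\<Sum>i\<in>S. \<Sum>j\<in>V - S. z i j) = (\<Sum>i\<in>S. z i v) + (\<Sum>i\<in>S. \<Sum>j\<in>?R. z i j)"
      unfolding VS using V by (simp add: sum.distrib)
    moreover have "(\<Sum>i\<in>insert v S. \<Sum>j\<in>?R. z i j) = (\<Sum>j\<in>?R. z v j) + (\<Sum>i\<in>S. \<Sum>j\<in>?R. z i j)"
      using fin S by (subst sum.insert) auto
    moreover have "(\<Sum>i\<in>S. \<Sum>j\<in>V - S. z i j) = 0" using S by (intro cut) auto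
    moreover have "(\<Sum>i\<in>insert v S. \<Sum>j\<in>?R. z i j) = 0"
      using S v fin by (intro cut) (auto simp: card_insert_if)
    moreover have "(\<Sum>i\<in>S. z i v) = (\<Sum>i\<in>S. z v i)" by (intro sum.cong sym refl)
    moreover have "(\<Sum>i\<in>V - {v}. z v i) = (\<Sum>i\<in>?R. z v i) + (\<Sum>i\<in>S. z v i)"
    proof -
      have "V - {v} = ?R \<union> S" using S by auto
      then show ?thesis using V fin by (simp only:) (intro sum.union_disjoint, auto)
    qed
    ultimately show ?thesis by linarith
  qed
  have swap: "z v u = z v u'" if "v \<in> V" "u \<in> V" "u' \<in> V" "u \<noteq> v" "u' \<noteq> v" "u \<noteq> u'" for v u u'
  proof -
    have "card (V - {v, u, u'}) = 2 * k - 2"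
      using that V by (subst card_Diff_subset) auto
    then have "k - 1 \<le> card (V - {v, u, u'})" by simp
    \<comment> \<open>\<open>insert u T\<close> and \<open>insert u' T\<close> both have
      \<open>k\<close> elements and avoid \<open>v\<close>, so \<open>half\<close> applies to each;
      \<open>z v u\<close> and \<open>z v u'\<close> are the only terms in which the two sums
      differ.\<close>
    then obtain T where T: "T \<subseteq> V - {v, u, u'}" "card T = k - 1"
      by (rule obtain_subset_with_card_n)
    then have fin: "finite T" using V finite_subset by blast
    have *: "2 * (\<Sum>i\<in>insert w T. z v i) = (\<Sum>i\<in>V - {v}. z v i)" if "w \<in> {u, u'}" for w
      using that \<open>v \<in> V\<close> \<open>u \<in> V\<close> \<open>u' \<in> V\<close> \<open>u \<noteq> v\<close> \<open>u' \<noteq> v\<close> T fin V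
      by (intro half) (auto simp: card_insert_if)
    have "u \<notin> T" "u' \<notin> T" using T by auto
    with *[of u] *[of u'] fin show ?thesis by simp
  qed
  have const: "z a b = z i j" if "a \<in> V" "b \<in> V" "a \<noteq> b" for a b
  proof -
    have a: "z a' b' = z a' b''" if "a' \<in> V" "b' \<in> V" "b'' \<in> V" "b' \<noteq> a'" "b'' \<noteq> a'" for a' b' b''
      using swap[of a' b' b''] that by (cases "b' = b''") auto
    show ?thesis
    proof (cases "i = a")
      case True
      then show ?thesis using a[of a b j] that ij by simp
    next
      case False
      \<comment> \<open>\<open>swap\<close> only moves within a row; symmetry at the entry
        \<open>z a i\<close> leads from row \<open>a\<close> to row \<open>i\<close>.\<close>
      then have "z a b = z a i" using that ij by (intro a) auto
      also have "\<dots> = z i a" by (rule sym)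
      also have "\<dots> = z i j" using False that ij by (intro a) auto
      finally show ?thesis .
    qed
  qed
  \<comment> \<open>A single balanced cut fixes the constant: it has \<open>k * (k + 1)\<close>
    crossing pairs, a positive number.\<close>
  have "k \<le> card V" using V by simp
  then obtain S where S: "S \<subseteq> V" "card S = k"
    by (rule obtain_subset_with_card_n)
  have cards: "card (V - S) = k + 1"
    using S V by (subst card_Diff_subset) (auto intro: finite_subset)
  have "0 = (\<Sum>a\<in>S. \<Sum>b\<in>V - S. z a b)" using S by (intro cut[symmetric]) auto
  also have "\<dots> = (\<Sum>a\<in>S. \<Sum>b\<in>V - S. z i j)"
    using S by (intro sum.cong refl const) auto
  also have "\<dots> = real k * (real (k + 1) * z i j)"
    using S cards by simp
  finally show ?thesis using V by simp
qed

section \<open>Indistinguishable graphs and cuts of odd cliques\<close>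

text \<open>Equal answers lead down the same branch, so agreement on the sets asked in the run on
  \<open>F\<close> is enough.\<close>

lemma queries_result_cong:
  assumes "\<And>S. S \<in> set (queries A F) \<Longrightarrow> F S = G S"
  shows "result A F = result A G"
  using assms by (induction A) auto

lemma cut_value_le_max_cut:
  "S \<subseteq> {1..n} \<Longrightarrow> cut_value n w S \<le> max_cut n w"
  unfolding max_cut_def by (intro Max_ge) auto

lemma cut_value_add_scaled:
  "cut_value n (\<lambda>i j. w i j + c * z i j) S = cut_value n w S + c * cut_value n z S"
  by (simp add: cut_value_def sum.distrib sum_distrib_left)

text \<open>Vertices above \<open>m\<close> are isolated, which lets even \<open>n\<close> use a
  clique of odd order \<open>n - 1\<close>. Odd order makes the cuts of both sizes \<open>k\<close>
  and \<open>k + 1\<close> maximum.\<close>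

definition complete_graph :: "nat \<Rightarrow> nat \<Rightarrow> nat \<Rightarrow> real" where
  "complete_graph m i j = (if i \<in> {1..m} \<and> j \<in> {1..m} \<and> i \<noteq> j then 1 else 0)"

lemma complete_graph_weighted: "complete_graph m \<in> weighted_graphs n"
  by (auto simp: weighted_graphs_def complete_graph_def)

lemma cut_value_restrict:
  assumes "m \<le> n" "S \<subseteq> {1..n}" "\<And>i j. i \<notin> {1..m} \<or> j \<notin> {1..m} \<Longrightarrow> w i j = 0"
  shows "cut_value n w S = (\<Sum>i\<in>S \<inter> {1..m}. \<Sum>j\<in>{1..m} - S. w i j)"
proof -
  have "cut_value n w S = (\<Sum>i\<in>S. \<Sum>j\<in>{1..m} - S. w i j)"
    unfolding cut_value_def using assms(1,2)
    by (intro sum.cong refl sum.mono_neutral_right) (auto intro!: assms(3))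
  also have "\<dots> = (\<Sum>i\<in>S \<inter> {1..m}. \<Sum>j\<in>{1..m} - S. w i j)"
    using assms(1,2) finite_subset[OF assms(2)]
    by (intro sum.mono_neutral_right) (auto intro!: sum.neutral assms(3))
  finally show ?thesis .
qed

lemma cut_value_complete_graph:
  assumes "m \<le> n" "S \<subseteq> {1..n}"
  shows "cut_value n (complete_graph m) S
    = real (card (S \<inter> {1..m})) * (real m - real (card (S \<inter> {1..m})))"
proof -
  have "cut_value n (complete_graph m) S
      = (\<Sum>i\<in>S \<inter> {1..m}. \<Sum>j\<in>{1..m} - S. complete_graph m i j)"
    using assms by (intro cut_value_restrict) (auto simp: complete_graph_def)
  also have "\<dots> = (\<Sum>i\<in>S \<inter> {1..m}. \<Sum>j\<in>{1..m} - S. 1)"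
    by (intro sum.cong refl) (auto simp: complete_graph_def)
  also have "\<dots> = real (card (S \<inter> {1..m})) * real (card ({1..m} - S))" by simp
  also have "real (card ({1..m} - S)) = real m - real (card (S \<inter> {1..m}))"
  proof -
    have "card ({1..m} - S) = m - card (S \<inter> {1..m})"
      by (simp add: card_Diff_subset_Int Int_commute)
    moreover have "card (S \<inter> {1..m}) \<le> m"
      using card_mono[of "{1..m}" "S \<inter> {1..m}"] by simp
    ultimately show ?thesis by simp
  qed
  finally show ?thesis .
qed

lemma max_cut_complete_graph_le:
  assumes "m = 2 * k + 1" "m \<le> n"
  shows "max_cut n (complete_graph m) \<le> real k * (real k + 1)"
proof -
  have *: "real a * (real m - real a) \<le> real k * (real k + 1)" for a
  proof -
    \<comment> \<open>The gap between the two sides of the claim is a product of consecutive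
      integers. Integrality is essential: the product is negative at \<open>k + 1/2\<close>.\<close>
    have "0 \<le> (int a - int k) * (int a - int k - 1)"
      by (cases "int a \<le> int k") (auto intro: mult_nonpos_nonpos)
    then have "real_of_int 0 \<le> real_of_int ((int a - int k) * (int a - int k - 1))"
      by (simp only: of_int_le_iff)
    then show ?thesis using assms by (simp add: algebra_simps)
  qed
  show ?thesis
    unfolding max_cut_def using assms *
    by (subst Max_le_iff) (auto simp: cut_value_complete_graph simp del: of_nat_add of_nat_mult)
qed

lemma invisible_perturbation_zero_on_balanced_cuts:
  assumes A: "computes_max_cut n A"
    and m: "m = 2 * k + 1" "m \<le> n"
    and z: "\<And>i j. z i j = z j i" "\<And>i. z i i = 0"
      "\<And>i j. i \<notin> {1..m} \<or> j \<notin> {1..m} \<Longrightarrow> z i j = 0"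
    and invisible: "\<And>S. S \<in> set (queries A (cut_value n (complete_graph m))) \<Longrightarrow> cut_value n z S = 0"
    and S: "S \<subseteq> {1..m}" "card S = k \<or> card S = k + 1"
  shows "cut_value n z S = 0"
proof (rule ccontr)
  assume nz: "cut_value n z S \<noteq> 0"
  \<comment> \<open>A common bound on all entries of \<open>z\<close>; the summand 1 keeps it
    positive for the division below.\<close>
  define B where "B = 1 + (\<Sum>i\<in>{1..m}. \<Sum>j\<in>{1..m}. \<bar>z i j\<bar>)"
  have B: "B > 0" unfolding B_def by (intro add_pos_nonneg sum_nonneg) auto
  have z_le: "\<bar>z i j\<bar> \<le> B" for i j
  proof (cases "i \<in> {1..m} \<and> j \<in> {1..m}")
    case True
    then have "\<bar>z i j\<bar> \<le> (\<Sum>j\<in>{1..m}. \<bar>z i j\<bar>)" by (intro member_le_sum) auto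
    also have "\<dots> \<le> (\<Sum>i\<in>{1..m}. \<Sum>j\<in>{1..m}. \<bar>z i j\<bar>)"
      using True by (intro member_le_sum[of i _ "\<lambda>i. \<Sum>j\<in>{1..m}. \<bar>z i j\<bar>"]) (auto intro: sum_nonneg)
    finally show ?thesis by (simp add: B_def)
  next
    case False
    then have "z i j = 0" using z(3) by blast
    with B show ?thesis by simp
  qed
  \<comment> \<open>The sign makes the perturbation increase the cut \<open>S\<close>; the size
    keeps the clique weights \<open>1 + c * z i j\<close> non-negative.\<close>
  define c where "c = sgn (cut_value n z S) / B"
  have c: "\<bar>c\<bar> = 1 / B" using nz B by (simp add: c_def abs_divide abs_sgn_eq)
  define w where "w = (\<lambda>i j. complete_graph m i j + c * z i j)"
  have "\<bar>c * z i j\<bar> \<le> 1" for i j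
    using z_le[of i j] B by (simp add: abs_mult c)
  then have ge: "1 + c * z i j \<ge> 0" for i j
    by (smt (verit))
  have w: "w \<in> weighted_graphs n"
    unfolding weighted_graphs_def w_def
    using z ge by (auto simp: complete_graph_def)
  have ans: "cut_value n w Q = cut_value n (complete_graph m) Q + c * cut_value n z Q" for Q
    unfolding w_def by (rule cut_value_add_scaled)
  have "max_cut n w = result A (cut_value n w)"
    using A w by (simp add: computes_max_cut_def)
  also have "\<dots> = result A (cut_value n (complete_graph m))"
    by (rule queries_result_cong[symmetric]) (simp add: ans invisible)
  also have "\<dots> = max_cut n (complete_graph m)"
    using A complete_graph_weighted by (simp add: computes_max_cut_def)
  also have "\<dots> \<le> real k * (real k + 1)" by (rule max_cut_complete_graph_le[OF m])
  also have "\<dots> = cut_value n (complete_graph m) S"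
  proof -
    have "S \<inter> {1..m} = S" "S \<subseteq> {1..n}" using S m by auto
    then show ?thesis using S m by (auto simp: cut_value_complete_graph algebra_simps)
  qed
  also have "\<dots> < cut_value n w S"
  proof -
    have "c * cut_value n z S = \<bar>cut_value n z S\<bar> / B" by (simp add: c_def abs_sgn mult.commute)
    then show ?thesis using nz B by (simp add: ans)
  qed
  also have "\<dots> \<le> max_cut n w" using S m by (intro cut_value_le_max_cut) auto
  finally show False by simp
qed

section \<open>Counting queries against edges\<close>

text \<open>The unknowns are the perturbations of the \<open>m choose 2\<close> edge weights, and
  every query imposes one homogeneous linear equation on them.\<close>

lemma odd_clique_query_lower_bound:
  assumes A: "computes_max_cut n A" and m: "odd m" "m \<ge> 3" "m \<le> n"
  shows "num_queries A (cut_value n (complete_graph m)) \<ge> m choose 2"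
proof (rule ccontr)
  assume less: "\<not> ?thesis"
  obtain k where k: "m = 2 * k + 1" using m by (elim oddE)
  define P where "P = {e. e \<subseteq> {1..m} \<and> card e = 2}"
  have P: "finite P" "card P = m choose 2"
    by (auto simp: P_def n_subsets)
  \<comment> \<open>\<open>a S e\<close> is the coefficient of the weight of \<open>e\<close> in the
    cut value of \<open>S\<close>, obtained from the graph with the single edge
    \<open>e\<close>.\<close>
  define a where "a = (\<lambda>S e. cut_value n (\<lambda>i j. if {i, j} = e then 1 else 0) S)"
  define Qs where "Qs = queries A (cut_value n (complete_graph m))"
  have "length (map a Qs) < card P"
    using less P by (simp add: Qs_def num_queries_def)
  from homogeneous_system_nontrivial_solution[OF P(1) this]
  obtain x e where e: "e \<in> P" "x e \<noteq> 0"
    and x: "\<And>S. S \<in> set Qs \<Longrightarrow> (\<Sum>e\<in>P. a S e * x e) = 0"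
    by auto
  \<comment> \<open>The edge vector \<open>x\<close> as a symmetric matrix; the diagonal vanishes
    because members of \<open>P\<close> have two elements.\<close>
  define z where "z = (\<lambda>i j. \<Sum>e\<in>P. (if {i, j} = e then 1 else 0) * x e)"
  have z_eq: "z i j = (if {i, j} \<in> P then x {i, j} else 0)" for i j
  proof -
    have "z i j = (\<Sum>e\<in>P. if {i, j} = e then x e else 0)"
      unfolding z_def by (intro sum.cong) auto
    then show ?thesis using P by simp
  qed
  have cut_z: "cut_value n z S = (\<Sum>e\<in>P. a S e * x e)" for S
  proof -
    have "(\<Sum>e\<in>P. a S e * x e)
        = (\<Sum>e\<in>P. \<Sum>i\<in>S. \<Sum>j\<in>{1..n} - S. (if {i, j} = e then 1 else 0) * x e)"
      unfolding a_def cut_value_def sum_distrib_right ..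
    also have "\<dots> = (\<Sum>i\<in>S. \<Sum>e\<in>P. \<Sum>j\<in>{1..n} - S. (if {i, j} = e then 1 else 0) * x e)"
      by (rule sum.swap)
    also have "\<dots> = cut_value n z S"
      unfolding cut_value_def z_def by (intro sum.cong refl sum.swap)
    finally show ?thesis ..
  qed
  have z: "z i j = z j i" "z i i = 0" "i \<notin> {1..m} \<or> j \<notin> {1..m} \<Longrightarrow> z i j = 0" for i j
    by (auto simp: z_eq P_def insert_commute)
  have balanced: "cut_value n z S = 0" if "S \<subseteq> {1..m}" "card S = k \<or> card S = k + 1" for S
  proof (rule invisible_perturbation_zero_on_balanced_cuts[where z = z, OF A k m(3) z _ that])
    show "cut_value n z Q = 0" if "Q \<in> set (queries A (cut_value n (complete_graph m)))" for Q
      using x[of Q] that by (simp add: cut_z Qs_def)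
  qed
  have cuts: "(\<Sum>i\<in>S. \<Sum>j\<in>{1..m} - S. z i j) = 0"
    if S: "S \<subseteq> {1..m}" "card S = k \<or> card S = k + 1" for S
  proof -
    have "cut_value n z S = (\<Sum>i\<in>S \<inter> {1..m}. \<Sum>j\<in>{1..m} - S. z i j)"
      using S m by (intro cut_value_restrict z) auto
    with S balanced[OF S] show ?thesis by (simp add: Int_absorb2)
  qed
  have V: "finite {1..m}" "card {1..m} = 2 * k + 1" "k \<ge> 1" using k m by auto
  have z0: "z i j = 0" if "i \<in> {1..m}" "j \<in> {1..m}" "i \<noteq> j" for i j
    by (rule balanced_cuts_determine_weights[where z = z, OF V z(1) cuts that])
  obtain i j where "e = {i, j}" "i \<noteq> j"
    using e by (auto simp: P_def card_2_iff)
  with e z0[of i j] show False by (auto simp: z_eq P_def)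
qed

lemma query_lower_bound:
  assumes "computes_max_cut n A" "n \<ge> 3"
  shows "\<exists>w\<in>weighted_graphs n.
    num_queries A (cut_value n w) \<ge> (if odd n then n choose 2 else (n - 1) choose 2)"
proof (cases "odd n")
  case True
  then show ?thesis
    using odd_clique_query_lower_bound[of n A n] assms complete_graph_weighted by auto
next
  case False
  \<comment> \<open>Evenness improves \<open>n \<ge> 3\<close> to \<open>n \<ge> 4\<close>, so the
    smaller clique still has at least 3 vertices.\<close>
  then have "odd (n - 1)" "n - 1 \<ge> 3" using assms by presburger+
  then show ?thesis
    using odd_clique_query_lower_bound[of n A "n - 1"] assms False complete_graph_weighted by auto
qed

text \<open>An optimal algorithm exists, so the lower bound for every algorithm applies to it; the
  weaker of the two parity bounds covers all \<open>n\<close>.\<close>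

lemma max_cut_query_complexity_ge:
  assumes "n \<ge> 3"
  shows "max_cut_query_complexity n \<ge> (n - 1) choose 2"
proof -
  obtain A where A: "computes_max_cut n A"
    "\<And>w. w \<in> weighted_graphs n \<Longrightarrow> num_queries A (cut_value n w) \<le> max_cut_query_complexity n"
    using max_cut_query_complexity_attained by blast
  have "(n - 1) choose 2 \<le> (if odd n then n choose 2 else (n - 1) choose 2)"
    by (simp add: binomial_right_mono)
  then show ?thesis using query_lower_bound[OF A(1) assms] A(2) by (meson order_trans)
qed

theorem theoremA1:
  shows "(\<forall>n::nat. \<forall>A::cut_algorithm. n \<ge> 3 \<longrightarrow> computes_max_cut n A \<longrightarrow>
            (odd n \<longrightarrow> (\<exists>w\<in>weighted_graphs n. num_queries A (cut_value n w) \<ge> n choose 2)) \<and>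
            (even n \<longrightarrow> (\<exists>w\<in>weighted_graphs n. num_queries A (cut_value n w) \<ge> (n - 1) choose 2)))
         \<and> (\<lambda>n. real (max_cut_query_complexity n)) \<in> \<Omega>(\<lambda>n. (real n)\<^sup>2)"
proof (intro conjI allI impI)
  fix n A assume "n \<ge> 3" "computes_max_cut n A"
  note * = query_lower_bound[OF this(2,1)]
  show "\<exists>w\<in>weighted_graphs n. num_queries A (cut_value n w) \<ge> n choose 2" if "odd n"
    using * that by simp
  show "\<exists>w\<in>weighted_graphs n. num_queries A (cut_value n w) \<ge> (n - 1) choose 2" if "even n"
    using * that by simp
next
  have "real (max_cut_query_complexity n) \<ge> 1/9 * (real n)\<^sup>2" if "n \<ge> 3" for n
  proof -
    \<comment> \<open>The product is 18 times the difference of the two sides below. The constant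
      1/9 gives equality at \<open>n = 3\<close>.\<close>
    have "0 \<le> (real n - 3) * (7 * real n - 6)" using that by simp
    then have "1/9 * (real n)\<^sup>2 \<le> (real n - 1) * (real n - 2) / 2"
      by (simp add: algebra_simps power2_eq_square)
    also have "\<dots> = real ((n - 1) choose 2)"
    proof -
      have "even ((n - 1) * (n - 1 - 1))" by simp
      then show ?thesis using that by (simp add: choose_two real_of_nat_div of_nat_diff)
    qed
    also have "\<dots> \<le> real (max_cut_query_complexity n)"
      using max_cut_query_complexity_ge[OF that] by simp
    finally show ?thesis .
  qed
  then show "(\<lambda>n. real (max_cut_query_complexity n)) \<in> \<Omega>(\<lambda>n. (real n)\<^sup>2)"
    by (intro landau_omega.bigI[of "1/9"] eventually_sequentiallyI[of 3]) auto
qed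

end
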